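(* There exists an idempotent right-distributive strong bimonoid which is weakly locally finite but not locally finite.
   Context: A strong bimonoid is an algebra $(B,\oplus,\otimes,\mathbf 0,\mathbf 1)$ such that $(B,\oplus,\mathbf 0)$ is a commutative monoid, $(B,\otimes,\mathbf 1)$ is a monoid, and $b\otimes\mathbf 0=\mathbf 0\otimes b=\mathbf 0$ for all $b\in B$. It is right-distributive if $(a\oplus b)\otimes c=(a\otimes c)\oplus(b\otimes c)$ for all $a,b,c$, and idempotent if $b\oplus b=b$ for all $b$. It is locally finite if for each finite $A\subseteq B$, the smallest subset of $B$ containing $A\cup\{\mathbf 0,\mathbf 1\}$ and closed under $\oplus$ and $\otimes$ is finite. The weak closure $\mathrm{wcl}(A)$ of $A\subseteq B$ is the smallest $C\subseteq B$ such that $A\cup\{\mathbf 0,\mathbf 1\}\subseteq C$ and, for all $b,b'\in C$ and $a\in A$, $b\oplus b'\in C$ and $b\otimes a\in C$. The strong bimonoid is weakly locally finite if $\mathrm{wcl}(A)$ is finite for each finite $A\subseteq B$. *)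

theory Defs
  imports "HOL-Algebra.Ring"
begin

locale strong_bimonoid = abelian_monoid B + monoid B for B (structure) +
  assumes l_null: "b \<in> carrier B \<Longrightarrow> \<zero> \<otimes> b = \<zero>"
    and r_null: "b \<in> carrier B \<Longrightarrow> b \<otimes> \<zero> = \<zero>"

locale right_distributive_strong_bimonoid = strong_bimonoid +
  assumes right_distrib:
    "\<lbrakk>a \<in> carrier B; b \<in> carrier B; c \<in> carrier B\<rbrakk> \<Longrightarrow> (a \<oplus> b) \<otimes> c = (a \<otimes> c) \<oplus> (b \<otimes> c)"

locale idempotent_strong_bimonoid = strong_bimonoid +
  assumes add_idem: "b \<in> carrier B \<Longrightarrow> b \<oplus> b = b"

(* The two inductive sets below do not mention the carrier: for A \<subseteq> carrier B they stay inside
   carrier B (closure lemmas below), so they are the smallest subsets of B with these properties. *)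

inductive_set bimonoid_closure :: "('a, 'm) ring_scheme \<Rightarrow> 'a set \<Rightarrow> 'a set"
  for B (structure) and A where
    base: "a \<in> A \<Longrightarrow> a \<in> bimonoid_closure B A"
  | zero: "\<zero> \<in> bimonoid_closure B A"
  | one: "\<one> \<in> bimonoid_closure B A"
  | add: "\<lbrakk>b \<in> bimonoid_closure B A; b' \<in> bimonoid_closure B A\<rbrakk>
      \<Longrightarrow> b \<oplus> b' \<in> bimonoid_closure B A"
  | mult: "\<lbrakk>b \<in> bimonoid_closure B A; b' \<in> bimonoid_closure B A\<rbrakk>
      \<Longrightarrow> b \<otimes> b' \<in> bimonoid_closure B A"

inductive_set wcl :: "('a, 'm) ring_scheme \<Rightarrow> 'a set \<Rightarrow> 'a set"
  for B (structure) and A where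
    base: "a \<in> A \<Longrightarrow> a \<in> wcl B A"
  | zero: "\<zero> \<in> wcl B A"
  | one: "\<one> \<in> wcl B A"
  | add: "\<lbrakk>b \<in> wcl B A; b' \<in> wcl B A\<rbrakk> \<Longrightarrow> b \<oplus> b' \<in> wcl B A"
  | mult: "\<lbrakk>b \<in> wcl B A; a \<in> A\<rbrakk> \<Longrightarrow> b \<otimes> a \<in> wcl B A"

lemma (in strong_bimonoid) bimonoid_closure_subset_carrier:
  assumes "A \<subseteq> carrier B"
  shows "bimonoid_closure B A \<subseteq> carrier B"
proof
  fix x assume "x \<in> bimonoid_closure B A"
  then show "x \<in> carrier B" by induction (use assms in auto)
qed

lemma (in strong_bimonoid) wcl_subset_carrier:
  assumes "A \<subseteq> carrier B"
  shows "wcl B A \<subseteq> carrier B"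
proof
  fix x assume "x \<in> wcl B A"
  then show "x \<in> carrier B" by induction (use assms in auto)
qed

definition locally_finite :: "('a, 'm) ring_scheme \<Rightarrow> bool" where
  "locally_finite B \<longleftrightarrow> (\<forall>A. finite A \<and> A \<subseteq> carrier B \<longrightarrow> finite (bimonoid_closure B A))"

definition weakly_locally_finite :: "('a, 'm) ring_scheme \<Rightarrow> bool" where
  "weakly_locally_finite B \<longleftrightarrow> (\<forall>A. finite A \<and> A \<subseteq> carrier B \<longrightarrow> finite (wcl B A))"

end

theory Submission
  imports Defs "HOL-Library.Nat_Bijection"
begin

text \<open>
  For a right-distributive idempotent strong bimonoid, \<open>wcl(A)\<close> consists of the finite sums of
  products of elements of \<open>A\<close>, whereas the full closure of \<open>A\<close> may also form products
  \<open>x \<otimes> (y \<oplus> z)\<close>, which need not decompose. The example makes such products climb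
  an infinite ladder, while products without sums on the right collapse.

  Take the free semilattice (finite sets under union) over symbols \<open>e\<close>, \<open>a\<close> and
  \<open>t\<^sub>0, t\<^sub>1, \<dots>\<close>, where \<open>{e}\<close> is the unit. Right-distributivity says that a product is
  determined by letting single symbols act from the left on finite sets. A rung \<open>t\<^sub>i\<close> sends every
  set but the unit to \<open>\<emptyset>\<close>. The symbol \<open>a\<close> climbs: it sends \<open>{t\<^sub>i, t\<^sub>i\<^sub>+\<^sub>1}\<close> to
  \<open>{t\<^sub>i\<^sub>+\<^sub>2}\<close> and all other sets of symbols different from \<open>e\<close> to \<open>\<emptyset>\<close>. Its values on
  sets containing \<open>e\<close> are chosen so that the multiplication is associative (\<open>act_mul\<close>).

  From \<open>a\<close>, \<open>t\<^sub>0\<close>, \<open>t\<^sub>1\<close> one reaches every \<open>t\<^sub>i\<close>, so the structure is not locally finite. For weak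
  closures, however, right factors come from the fixed finite set \<open>A\<close>. Multiplying by \<open>c \<in> A\<close> on
  the right can only create symbols that occur in \<open>c\<close> or in the value of \<open>a\<close> at \<open>c\<close>, so \<open>wcl(A)\<close>
  lives on finitely many symbols.
\<close>

section \<open>The multiplication on sets of symbols\<close>

text \<open>
  The symbols are coded by natural numbers: \<open>0\<close> is \<open>e\<close>, \<open>1\<close> is \<open>a\<close>, and \<open>i + 2\<close> is
  \<open>t\<^sub>i\<close>. The function below is the action of \<open>a\<close>. Its first branch has the following reason. If
  \<open>s\<close> consists of rungs, then \<open>({e} \<union> s) z = z\<close> for every \<open>z\<close> other than the unit, hence
  \<open>a ({e} \<union> s)\<close> must act on such \<open>z\<close> as \<open>a\<close> does. If \<open>s\<close> also contains \<open>a\<close>, then \<open>({e} \<union> s) z\<close> is \<open>z\<close>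
  together with its image under \<open>a\<close>. The symbol \<open>a\<close> sends such a union to \<open>\<emptyset>\<close>
  (\<open>climb_Un_climb\<close>), so \<open>a ({e} \<union> s)\<close> must act as zero.
\<close>

definition climb :: "nat set \<Rightarrow> nat set" where
  "climb y = (if 0 \<in> y then (if 1 \<in> y then {} else {1})
              else {n + 2 | n. 2 \<le> n \<and> y = {n, n + 1}})"

definition act :: "nat \<Rightarrow> nat set \<Rightarrow> nat set" where
  "act g y = (if g = 0 then y else if g = 1 then climb y else if y = {0} then {g} else {})"

definition mul :: "nat set \<Rightarrow> nat set \<Rightarrow> nat set" where
  "mul x y = (\<Union>g\<in>x. act g y)"

lemma climb_empty [simp]: "climb {} = {}"
  by (simp add: climb_def)

lemma climb_unit [simp]: "climb {0} = {1}"
  by (simp add: climb_def)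

lemma climb_pair: "2 \<le> n \<Longrightarrow> climb {n, n + 1} = {n + 2}"
  by (auto simp: climb_def doubleton_eq_iff)

lemma climb_cases:
  assumes "0 \<notin> y"
  obtains "climb y = {}"
  | n where "2 \<le> n" "y = {n, n + 1}" "climb y = {n + 2}"
proof (cases "\<exists>n\<ge>2. y = {n, n + 1}")
  case True
  with that(2) climb_pair show thesis by blast
next
  case False
  with assms have "climb y = {}" by (auto simp: climb_def)
  with that(1) show thesis .
qed

lemma finite_climb: "finite (climb y)"
proof (cases "0 \<in> y")
  case True
  then show ?thesis by (simp add: climb_def)
next
  case False
  then show ?thesis by (cases rule: climb_cases) auto
qed

lemma climb_singleton: "n \<noteq> 0 \<Longrightarrow> climb {n} = {}"
  by (auto simp: climb_def)

lemma climb_climb: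
  assumes "z \<noteq> {0}"
  shows "climb (climb z) = {}"
proof (cases "0 \<in> z")
  case True
  then show ?thesis by (simp add: climb_def[of z] climb_singleton)
next
  case False
  then show ?thesis by (cases rule: climb_cases) (auto simp: climb_singleton)
qed

text \<open>Two consecutive rungs together with the next one no longer form a pair.\<close>

lemma climb_Un_climb: "climb (z \<union> climb z) = {}"
proof (cases "0 \<in> z")
  case True
  then show ?thesis by (auto simp: climb_def)
next
  case False
  then show ?thesis
  proof (cases rule: climb_cases)
    case 1
    then show ?thesis by simp
  next
    case (2 n)
    have "{n, n + 1} \<union> {n + 2} \<noteq> {m, m + 1}" for m
    proof
      assume "{n, n + 1} \<union> {n + 2} = {m, m + 1}"
      then have "card {n, n + 1, n + 2} = card {m, m + 1}" by (simp add: insert_commute)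
      then show False by simp
    qed
    with 2 show ?thesis by (simp add: climb_def)
  qed
qed

lemma act_empty [simp]: "act g {} = {}"
  by (simp add: act_def)

lemma act_zero [simp]: "act 0 y = y"
  by (simp add: act_def)

lemma act_unit [simp]: "act g {0} = {g}"
  by (simp add: act_def)

lemma finite_act: "finite y \<Longrightarrow> finite (act g y)"
  by (simp add: act_def finite_climb)

lemma finite_mul: "finite x \<Longrightarrow> finite y \<Longrightarrow> finite (mul x y)"
  by (simp add: mul_def finite_act)

lemma mul_empty_left [simp]: "mul {} y = {}"
  and mul_empty_right [simp]: "mul x {} = {}"
  and mul_unit_left [simp]: "mul {0} y = y"
  and mul_unit_right [simp]: "mul x {0} = x"
  by (auto simp: mul_def act_def)

lemma mul_singleton: "mul {g} y = act g y"
  by (simp add: mul_def)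

lemma mul_Un: "mul (x \<union> x') y = mul x y \<union> mul x' y"
  by (simp add: mul_def)

text \<open>Away from the unit, a left factor matters only through whether it contains \<open>e\<close> and \<open>a\<close>.\<close>

lemma mul_non_unit:
  assumes "z \<noteq> {0}"
  shows "mul y z = (if 0 \<in> y then z else {}) \<union> (if 1 \<in> y then climb z else {})"
  using assms by (auto simp: mul_def act_def split: if_splits)

lemma mul_eq_unitD:
  assumes "mul y z = {0}"
  shows "z = {0}"
proof (rule ccontr)
  assume z: "z \<noteq> {0}"
  have "0 \<notin> climb z" by (auto simp: climb_def)
  with assms z show False
    by (auto simp: mul_non_unit split: if_splits)
qed

lemma climb_mul:
  assumes "y \<noteq> {0}" "z \<noteq> {0}"
  shows "mul (climb y) z = climb (mul y z)"
proof (cases "0 \<in> y")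
  case True
  then show ?thesis
    using climb_Un_climb[of z] by (simp add: mul_non_unit[OF assms(2)] climb_def[of y])
next
  case False
  \<comment> \<open>Here \<open>climb y\<close> consists of rungs, which annihilate \<open>z\<close>.\<close>
  then have "0 \<notin> climb y" "1 \<notin> climb y" by (auto simp: climb_def)
  with False show ?thesis
    using climb_climb[OF assms(2)] by (simp add: mul_non_unit[OF assms(2)])
qed

text \<open>
  Associativity for a single symbol on the left. Non-units are closed under multiplication
  (\<open>mul_eq_unitD\<close>), so both sides are empty if that symbol is a rung and \<open>y\<close>, \<open>z\<close> are non-units.
\<close>

lemma act_mul: "mul (act g y) z = act g (mul y z)"
proof (cases "y = {0} \<or> z = {0}")
  case True
  then show ?thesis by (auto simp: mul_singleton)
next
  case False
  then have "mul y z \<noteq> {0}" using mul_eq_unitD by blast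
  with False show ?thesis by (simp add: act_def climb_mul)
qed

lemma mul_assoc: "mul (mul x y) z = mul x (mul y z)"
proof -
  have "mul (mul x y) z = (\<Union>g\<in>x. mul (act g y) z)" by (auto simp: mul_def)
  also have "\<dots> = mul x (mul y z)" by (simp add: act_mul mul_def[of x])
  finally show ?thesis .
qed

section \<open>The strong bimonoid\<close>

text \<open>Finite sets of symbols are coded by natural numbers through their binary expansions.\<close>

definition ladder :: "nat ring" where
  "ladder = \<lparr>carrier = UNIV,
     monoid.mult = (\<lambda>x y. set_encode (mul (set_decode x) (set_decode y))),
     one = set_encode {0}, zero = set_encode {},
     add = (\<lambda>x y. set_encode (set_decode x \<union> set_decode y))\<rparr>"

lemma carrier_ladder [simp]: "carrier ladder = UNIV"
  by (simp add: ladder_def)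

lemma decode_ladder:
  "set_decode (x \<otimes>\<^bsub>ladder\<^esub> y) = mul (set_decode x) (set_decode y)"
  "set_decode \<one>\<^bsub>ladder\<^esub> = {0}"
  "set_decode \<zero>\<^bsub>ladder\<^esub> = {}"
  "set_decode (x \<oplus>\<^bsub>ladder\<^esub> y) = set_decode x \<union> set_decode y"
  by (simp_all add: ladder_def finite_mul del: set_encode_insert)

lemma ladder_eqI: "set_decode x = set_decode y \<Longrightarrow> x = y"
  by (metis set_decode_inverse)

lemma strong_bimonoid_ladder: "strong_bimonoid ladder"
proof
  show "x \<otimes>\<^bsub>ladder\<^esub> y \<otimes>\<^bsub>ladder\<^esub> z = x \<otimes>\<^bsub>ladder\<^esub> (y \<otimes>\<^bsub>ladder\<^esub> z)" for x y z
    by (rule ladder_eqI) (simp add: decode_ladder mul_assoc)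
qed (auto intro!: ladder_eqI simp: decode_ladder)

lemma idempotent_ladder: "idempotent_strong_bimonoid ladder"
  by (intro idempotent_strong_bimonoid.intro strong_bimonoid_ladder
      idempotent_strong_bimonoid_axioms.intro ladder_eqI) (simp add: decode_ladder)

lemma right_distributive_ladder: "right_distributive_strong_bimonoid ladder"
  by (intro right_distributive_strong_bimonoid.intro strong_bimonoid_ladder
      right_distributive_strong_bimonoid_axioms.intro ladder_eqI) (simp add: decode_ladder mul_Un)

section \<open>Finiteness of closures\<close>

lemma mul_subset:
  assumes "x \<subseteq> U" "y \<subseteq> U" "climb y \<subseteq> U"
  shows "mul x y \<subseteq> U"
  using assms by (auto simp: mul_def act_def split: if_splits)

text \<open>
  Right factors in a weak closure lie in \<open>A\<close>, so the symbol \<open>a\<close> only ever acts on elements of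
  \<open>A\<close>. Their symbols, those of their images and \<open>e\<close> make up a finite set \<open>U\<close> that bounds
  the weak closure.
\<close>

lemma weakly_locally_finite_ladder: "weakly_locally_finite ladder"
  unfolding weakly_locally_finite_def
proof (intro allI impI)
  fix A assume A: "finite A \<and> A \<subseteq> carrier ladder"
  define U where "U = insert 0 (\<Union>c\<in>A. set_decode c \<union> climb (set_decode c))"
  have "finite U" using A by (simp add: U_def finite_climb)
  have gen: "set_decode c \<subseteq> U" "climb (set_decode c) \<subseteq> U" if "c \<in> A" for c
    using that by (auto simp: U_def)
  have "set_decode b \<subseteq> U" if "b \<in> wcl ladder A" for b
    using that
  proof induction
    case (mult b c)
    then show ?case using gen[of c] by (simp add: decode_ladder mul_subset)
  qed (simp_all add: decode_ladder gen, simp add: U_def)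
  then have "wcl ladder A \<subseteq> set_encode ` Pow U"
    by (metis PowI image_eqI set_decode_inverse subsetI)
  with \<open>finite U\<close> show "finite (wcl ladder A)"
    by (meson finite_Pow_iff finite_imageI finite_subset)
qed

text \<open>Starting from \<open>a\<close>, \<open>t\<^sub>0\<close> and \<open>t\<^sub>1\<close>, the climbs \<open>t\<^sub>i\<^sub>+\<^sub>2 = a (t\<^sub>i + t\<^sub>i\<^sub>+\<^sub>1)\<close> yield all rungs.\<close>

lemma not_locally_finite_ladder: "\<not> locally_finite ladder"
proof
  define A where "A = {set_encode {1}, set_encode {2}, set_encode {3}}"
  define rung where "rung i = set_encode {i + 2}" for i :: nat
  let ?C = "bimonoid_closure ladder A"
  assume "locally_finite ladder"
  then have fin: "finite ?C" by (simp add: locally_finite_def A_def)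
  have a: "set_encode {1} \<in> ?C"
    by (rule bimonoid_closure.base) (simp add: A_def)
  have decode_rung: "set_decode (rung i) = {i + 2}" for i
    unfolding rung_def by (rule set_encode_inverse) simp
  have decode_a: "set_decode (set_encode {1}) = {1}"
    by (rule set_encode_inverse) simp
  have step: "rung (i + 2) = set_encode {1} \<otimes>\<^bsub>ladder\<^esub> (rung i \<oplus>\<^bsub>ladder\<^esub> rung (i + 1))" for i
  proof (rule ladder_eqI)
    have "set_decode (set_encode {1} \<otimes>\<^bsub>ladder\<^esub> (rung i \<oplus>\<^bsub>ladder\<^esub> rung (i + 1)))
        = act 1 {i + 2, i + 2 + 1}"
      unfolding decode_ladder decode_a decode_rung mul_singleton by (simp add: insert_commute)
    also have "\<dots> = {i + 2 + 2}"
      unfolding act_def using climb_pair[of "i + 2"] by simp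
    finally show "set_decode (rung (i + 2)) =
        set_decode (set_encode {1} \<otimes>\<^bsub>ladder\<^esub> (rung i \<oplus>\<^bsub>ladder\<^esub> rung (i + 1)))"
      by (simp only: decode_rung)
  qed
  have "rung i \<in> ?C \<and> rung (i + 1) \<in> ?C" for i
  proof (induction i)
    case 0
    have "rung 0 \<in> A" "rung 1 \<in> A" by (simp_all add: rung_def A_def)
    then show ?case by (simp add: bimonoid_closure.base)
  next
    case (Suc i)
    then have "rung (i + 2) \<in> ?C"
      unfolding step by (intro bimonoid_closure.mult bimonoid_closure.add a) auto
    with Suc show ?case by simp
  qed
  then have "range rung \<subseteq> ?C" by auto
  moreover have "inj rung"
    by (rule injI) (metis add_right_cancel decode_rung singleton_inject)
  ultimately show False
    using fin finite_subset finite_imageD infinite_UNIV_nat by metis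
qed

theorem theorem7p2:
  "\<exists>B :: nat ring. idempotent_strong_bimonoid B \<and> right_distributive_strong_bimonoid B \<and>
     weakly_locally_finite B \<and> \<not> locally_finite B"
  using idempotent_ladder right_distributive_ladder weakly_locally_finite_ladder
    not_locally_finite_ladder by blast

end
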